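(* Let $A$ and $B$ be nonempty finite multisets of positive integers such that $\{A,B\}$ is an irreducible pair. Then $|A|\leq \max(B)$ and $|B|\leq \max(A)$. Consequently, for every integer $k>1$, $\ell(k)=2k-1$.
   Context: For a finite multiset $S$, $|S|$ is the number of elements of $S$ counted with multiplicity, $\max(S)$ is its largest element, and $\Sigma S=\sum_{s\in S}s$ (with multiplicity). For nonempty finite multisets $A,B$ of positive integers, the (unordered) pair $\{A,B\}$ is called irreducible if $\Sigma A=\Sigma B$ and for every nonempty proper multisubsets $A'\subsetneq A$ and $B'\subsetneq B$ one has $\Sigma A'\neq \Sigma B'$. For a positive integer $k$, an irreducible pair $\{A,B\}$ is called $k$-irreducible if $\max(A\cup B)\leq k$. The length of $\{A,B\}$ is $\ell(A,B)=|A|+|B|$, and $\ell(k)$ denotes the maximum of $\ell(A,B)$ over all $k$-irreducible pairs $\{A,B\}$. *)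

theory Defs
  imports "HOL-Library.Multiset"
begin

text \<open>
  Positive integers are represented as nonzero natural numbers.  The pairs are unordered:
  both predicates below and the length are symmetric in \<open>A\<close> and \<open>B\<close>, so an unordered pair
  is represented by its two members, taken in either order.
\<close>

definition irreducible_pair :: "nat multiset \<Rightarrow> nat multiset \<Rightarrow> bool" where
  "irreducible_pair A B \<longleftrightarrow>
     A \<noteq> {#} \<and> B \<noteq> {#} \<and> (\<forall>a \<in># A. a > 0) \<and> (\<forall>b \<in># B. b > 0) \<and>
     \<Sum>\<^sub># A = \<Sum>\<^sub># B \<and>
     (\<forall>A' B'. A' \<noteq> {#} \<and> A' \<subset># A \<and> B' \<noteq> {#} \<and> B' \<subset># B \<longrightarrow> \<Sum>\<^sub># A' \<noteq> \<Sum>\<^sub># B')"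

definition k_irreducible_pair :: "nat \<Rightarrow> nat multiset \<Rightarrow> nat multiset \<Rightarrow> bool" where
  "k_irreducible_pair k A B \<longleftrightarrow> irreducible_pair A B \<and> Max_mset (A \<union># B) \<le> k"

definition pair_length :: "nat multiset \<Rightarrow> nat multiset \<Rightarrow> nat" where
  "pair_length A B = size A + size B"

text \<open>
  \<open>Max\<close> is only specified on finite nonempty sets, so any equation evaluating \<open>max_length k\<close>
  carries the obligation that the set of lengths is finite and nonempty.
\<close>

definition max_length :: "nat \<Rightarrow> nat" where
  "max_length k = Max {pair_length A B | A B. k_irreducible_pair k A B}"

lemma irreducible_pair_commute: "irreducible_pair A B \<longleftrightarrow> irreducible_pair B A"
  unfolding irreducible_pair_def by (safe; simp; metis)

lemma k_irreducible_pair_commute: "k_irreducible_pair k A B \<longleftrightarrow> k_irreducible_pair k B A"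
  unfolding k_irreducible_pair_def
  by (simp add: irreducible_pair_commute[of A B] Un_commute)

lemma pair_length_commute: "pair_length A B = pair_length B A"
  by (simp add: pair_length_def)

end

theory Submission
  imports Defs
begin

text \<open>
  Enumerate \<open>A\<close> and \<open>B\<close> in any order, with prefix sums \<open>S i\<close> and \<open>T j\<close>. For \<open>i < |A|\<close> let \<open>j\<close> be
  least with \<open>T j \<ge> S i\<close>; then \<open>T j - S i\<close> lies in \<open>[0, max B)\<close>. If \<open>|A| > max B\<close>, two of these
  differences agree, so a nonempty proper block of \<open>A\<close> has the same sum as a block of \<open>B\<close>. For the
  maximal length, both maxima can equal \<open>k\<close> only if \<open>A = B = {k}\<close>, so \<open>|A| + |B| \<le> 2k - 1\<close>; the bound
  is attained by \<open>k - 1\<close> copies of \<open>k\<close> against \<open>k\<close> copies of \<open>k - 1\<close>.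
\<close>

lemma sum_mset_pos_nat:
  fixes A :: "nat multiset"
  assumes "A \<noteq> {#}" "\<forall>a \<in># A. a > 0"
  shows "\<Sum>\<^sub># A > 0"
  using assms by (cases A) auto

lemma sum_mset_strict_mono_nat:
  fixes A B :: "nat multiset"
  assumes "A \<subset># B" "\<forall>b \<in># B. b > 0"
  shows "\<Sum>\<^sub># A < \<Sum>\<^sub># B"
proof -
  obtain C where C: "B = A + C" "C \<noteq> {#}"
    using assms(1) by (metis add.right_neutral subset_mset.le_iff_add subset_mset.less_imp_le
        subset_mset.less_irrefl)
  then show ?thesis
    using sum_mset_pos_nat[of C] assms(2) by auto
qed

text \<open>Since all entries are positive, the sum of a nonempty proper \<open>A'\<close> lies
  strictly between 0 and the common total. So the cases \<open>B' = {#}\<close> and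
  \<open>B' = B\<close>, which the definition leaves out, cannot give equality either.\<close>

lemma irreducible_pair_no_equal_subsums:
  assumes "irreducible_pair A B" "A' \<noteq> {#}" "A' \<subset># A" "B' \<subseteq># B"
  shows "\<Sum>\<^sub># A' \<noteq> \<Sum>\<^sub># B'"
proof
  assume eq: "\<Sum>\<^sub># A' = \<Sum>\<^sub># B'"
  have irr: "\<forall>a \<in># A. a > 0" "\<Sum>\<^sub># A = \<Sum>\<^sub># B"
    using assms(1) by (auto simp: irreducible_pair_def)
  have "\<forall>a \<in># A'. a > 0"
    using irr(1) assms(3) by (meson mset_subset_eqD subset_mset.less_imp_le)
  then have "\<Sum>\<^sub># A' > 0"
    using sum_mset_pos_nat assms(2) by blast
  then have "B' \<noteq> {#}"
    using eq by auto
  moreover have "B' \<noteq> B"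
    using sum_mset_strict_mono_nat[OF assms(3) irr(1)] eq irr(2) by auto
  ultimately show False
    using assms eq by (auto simp: irreducible_pair_def subset_mset.less_le)
qed

text \<open>At the least \<open>j\<close> whose prefix sum reaches \<open>s\<close>, the previous
  prefix is still below \<open>s\<close> and the last entry adds at most \<open>m\<close>. If
  \<open>j = 0\<close>, the strict upper bound comes from \<open>m > 0\<close>.\<close>

lemma ex_prefix_sum_between:
  fixes xs :: "nat list"
  assumes "s \<le> sum_list xs" "\<forall>x \<in> set xs. x \<le> m" "m > 0"
  shows "\<exists>j. s \<le> sum_list (take j xs) \<and> sum_list (take j xs) < s + m"
proof -
  define j where "j = (LEAST j. s \<le> sum_list (take j xs))"
  have "s \<le> sum_list (take (length xs) xs)"
    using assms(1) by simp
  then have ge: "s \<le> sum_list (take j xs)"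
    unfolding j_def by (rule LeastI)
  have "sum_list (take j xs) < s + m"
  proof (cases j)
    case 0
    then show ?thesis using assms(3) by simp
  next
    case (Suc i)
    then have lt: "sum_list (take i xs) < s"
      unfolding j_def using not_less_Least[of i "\<lambda>j. s \<le> sum_list (take j xs)"] by auto
    \<comment> \<open>Past the end of \<open>xs\<close> both prefixes would be all of
      \<open>xs\<close>, so the sum could not cross \<open>s\<close>.\<close>
    have "i < length xs"
      using lt ge Suc by (cases "i < length xs") auto
    then have "sum_list (take j xs) = sum_list (take i xs) + xs ! i" "xs ! i \<le> m"
      using Suc assms(2) by (auto simp: take_Suc_conv_app_nth)
    with lt show ?thesis by linarith
  qed
  with ge show ?thesis by blast
qed

lemma sum_list_take_eq_add_block:
  fixes xs :: "nat list"
  assumes "i \<le> j"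
  shows "sum_list (take j xs) = sum_list (take i xs) + sum_list (drop i (take j xs))"
  using assms by (metis append_take_drop_id min.absorb1 sum_list_append take_take)

lemma mset_block_subseteq: "mset (drop i (take j xs)) \<subseteq># mset xs"
  by (metis append_take_drop_id mset_append mset_subset_eq_add_left mset_subset_eq_add_right
      subset_mset.order_trans)

lemma irreducible_pair_size_le:
  assumes irr: "irreducible_pair A B"
  shows "size A \<le> Max_mset B"
proof (rule ccontr)
  assume less: "\<not> size A \<le> Max_mset B"
  define m where "m = Max_mset B"
  obtain xs ys where xs: "mset xs = A" and ys: "mset ys = B"
    using ex_mset by metis
  have sum: "sum_list xs = sum_list ys"
    using irr by (simp add: irreducible_pair_def flip: xs ys sum_mset_sum_list)
  have bound: "\<forall>y \<in> set ys. y \<le> m"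
    unfolding m_def using ys by auto
  have "ys \<noteq> []" "\<forall>y \<in> set ys. y > 0"
    using irr ys by (auto simp: irreducible_pair_def)
  with bound have "m > 0"
    by (metis le_zero_eq list.set_intros(1) neq0_conv neq_Nil_conv)
  have "sum_list (take i xs) \<le> sum_list ys" for i
    by (metis append_take_drop_id le_add1 sum sum_list_append)
  then have "\<forall>i. \<exists>j. sum_list (take i xs) \<le> sum_list (take j ys) \<and>
      sum_list (take j ys) < sum_list (take i xs) + m"
    using ex_prefix_sum_between[OF _ bound \<open>m > 0\<close>] by blast
  then obtain j where j: "\<And>i. sum_list (take i xs) \<le> sum_list (take (j i) ys)"
      "\<And>i. sum_list (take (j i) ys) < sum_list (take i xs) + m"
    by metis
  \<comment> \<open>The first property of \<open>j\<close> makes this subtraction on naturals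
    exact.\<close>
  define d where "d i = sum_list (take (j i) ys) - sum_list (take i xs)" for i
  have "d i < m" for i
    using j[of i] \<open>m > 0\<close> by (simp add: d_def)
  then have "d ` {..<length xs} \<subseteq> {..<m}"
    by auto
  then have "card (d ` {..<length xs}) \<le> m"
    by (metis card_lessThan card_mono finite_lessThan)
  moreover have "m < length xs"
    using less xs m_def by auto
  \<comment> \<open>Pigeonhole: more than \<open>m\<close> indices, at most \<open>m\<close> values.
    The index \<open>length xs\<close> is left out so that the block between two colliding indices
    is proper.\<close>
  ultimately have "\<not> inj_on d {..<length xs}"
    by (auto dest: card_image)
  then obtain p q where pq: "p < q" "q < length xs" "d p = d q"
    by (auto simp: inj_on_def) (metis linorder_neqE_nat)
  let ?A = "drop p (take q xs)" and ?B = "drop (j p) (take (j q) ys)"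
  have ne: "?A \<noteq> []" and len: "length ?A < length xs"
    using pq by auto
  have sub: "mset ?A \<subset># A"
    using mset_block_subseteq[of p q xs] len xs
    by (metis nat_less_le size_mset subset_mset.le_imp_less_or_eq)
  have eqA: "sum_list (take q xs) = sum_list (take p xs) + sum_list ?A"
    using pq(1) by (intro sum_list_take_eq_add_block) simp
  have pos: "sum_list ?A > 0"
    using sum_mset_pos_nat[of "mset ?A"] ne irr mset_subset_eqD[OF subset_mset.less_imp_le[OF sub]]
    by (simp add: irreducible_pair_def sum_mset_sum_list)
  \<comment> \<open>As \<open>d p = d q\<close>, both prefix sums grow by the same amount from
    \<open>p\<close> to \<open>q\<close>.\<close>
  have eqB: "sum_list (take (j q) ys) = sum_list (take (j p) ys) + sum_list ?A"
    using pq(3) j(1)[of p] j(1)[of q] eqA unfolding d_def by linarith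
  \<comment> \<open>The choice of \<open>j\<close> does not give monotonicity directly. But a
    shorter prefix at \<open>q\<close> could not have the larger sum that \<open>eqB\<close> and
    \<open>pos\<close> demand.\<close>
  have "j p \<le> j q"
  proof (rule ccontr)
    assume "\<not> j p \<le> j q"
    then show False
      using sum_list_take_eq_add_block[of "j q" "j p" ys] eqB pos by linarith
  qed
  from sum_list_take_eq_add_block[OF this, of ys] eqB
  have "\<Sum>\<^sub># (mset ?A) = \<Sum>\<^sub># (mset ?B)"
    by (simp add: sum_mset_sum_list)
  moreover have "mset ?B \<subseteq># B"
    using mset_block_subseteq ys by blast
  ultimately show False
    using irreducible_pair_no_equal_subsums[OF irr _ sub, of "mset ?B"] ne by simp
qed

text \<open>Otherwise the two copies of \<open>{#x#}\<close> would be forbidden submultisets with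
  equal sums.\<close>

lemma irreducible_pair_common_element:
  assumes irr: "irreducible_pair A B" and "x \<in># A" "x \<in># B"
  shows "A = {#x#}"
proof (rule ccontr)
  assume "A \<noteq> {#x#}"
  with assms(2) have "{#x#} \<subset># A"
    by (simp add: subset_mset.less_le)
  with irreducible_pair_no_equal_subsums[OF irr, of "{#x#}" "{#x#}"] assms(3) show False
    by simp
qed

lemma k_irreducible_pair_length_le:
  assumes k: "k > 1" and "k_irreducible_pair k A B"
  shows "pair_length A B \<le> 2 * k - 1"
proof -
  have irr: "irreducible_pair A B" and le: "Max_mset (A \<union># B) \<le> k"
    using assms(2) by (auto simp: k_irreducible_pair_def)
  have irr': "irreducible_pair B A"
    using irr irreducible_pair_commute[of A B] by simp
  have ne: "A \<noteq> {#}" "B \<noteq> {#}"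
    using irr by (auto simp: irreducible_pair_def)
  have mem: "Max_mset A \<in># A" "Max_mset B \<in># B"
    using ne by auto
  have max: "Max_mset A \<le> k" "Max_mset B \<le> k"
    using le ne by (auto simp: Max_Un)
  have size: "size A \<le> Max_mset B" "size B \<le> Max_mset A"
    using irreducible_pair_size_le[OF irr] irreducible_pair_size_le[OF irr'] by simp_all
  show ?thesis
  proof (cases "Max_mset A = k \<and> Max_mset B = k")
    case True
    with mem have "k \<in># A" "k \<in># B"
      by metis+
    then have "A = {#k#}" "B = {#k#}"
      using irreducible_pair_common_element irr irr' by metis+
    then show ?thesis
      using k by (simp add: pair_length_def)
  next
    \<comment> \<open>One maximum is at most \<open>k - 1\<close>, so the sizes add up to at most
      \<open>k + (k - 1)\<close>.\<close>
    case False
    then show ?thesis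
      using max size by (auto simp: pair_length_def)
  qed
qed

text \<open>Equal subsums would mean \<open>i * k = j * (k - 1)\<close>. By coprimality
  \<open>k\<close> divides \<open>j\<close>, which is impossible for
  \<open>0 < j < k\<close>.\<close>

lemma k_irreducible_pair_replicate:
  assumes k: "k > 1"
  shows "k_irreducible_pair k (replicate_mset (k - 1) k) (replicate_mset k (k - 1))"
proof -
  have "\<Sum>\<^sub># A' \<noteq> \<Sum>\<^sub># B'"
    if A': "A' \<noteq> {#}" "A' \<subset># replicate_mset (k - 1) k"
      and B': "B' \<noteq> {#}" "B' \<subset># replicate_mset k (k - 1)" for A' B'
  proof
    assume eq: "\<Sum>\<^sub># A' = \<Sum>\<^sub># B'"
    obtain i where i: "A' = replicate_mset i k"
      using msubseteq_replicate_msetE[OF subset_mset.less_imp_le[OF A'(2)]] by metis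
    obtain j where j: "B' = replicate_mset j (k - 1)"
      using msubseteq_replicate_msetE[OF subset_mset.less_imp_le[OF B'(2)]] by metis
    have "j < k" "j > 0"
      using j B' mset_subset_size[OF B'(2)] by auto
    have "k dvd j * (k - 1)"
      using eq i j by (metis dvd_triv_right sum_mset_replicate_mset of_nat_id)
    moreover have "coprime k (k - 1)"
      using k coprime_diff_one_left_nat[of k] by (simp add: coprime_commute)
    ultimately have "k dvd j"
      by (simp add: coprime_dvd_mult_left_iff)
    with \<open>j < k\<close> \<open>j > 0\<close> show False
      by (auto dest: dvd_imp_le)
  qed
  with k show ?thesis
    by (auto simp: k_irreducible_pair_def irreducible_pair_def)
qed

theorem theorem1:
  shows "(\<forall>A B :: nat multiset. irreducible_pair A B \<longrightarrow>
            size A \<le> Max_mset B \<and> size B \<le> Max_mset A) \<and>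
         (\<forall>k :: nat. k > 1 \<longrightarrow> max_length k = 2 * k - 1)"
proof (intro conjI allI impI)
  fix A B :: "nat multiset"
  assume "irreducible_pair A B"
  then show "size A \<le> Max_mset B" "size B \<le> Max_mset A"
    using irreducible_pair_size_le irreducible_pair_commute[of A B] by simp_all
next
  fix k :: nat
  assume k: "k > 1"
  let ?L = "{pair_length A B | A B. k_irreducible_pair k A B}"
  have le: "\<And>l. l \<in> ?L \<Longrightarrow> l \<le> 2 * k - 1"
    using k_irreducible_pair_length_le[OF k] by blast
  \<comment> \<open>The upper bound also supplies the finiteness without which \<open>Max\<close> is
    unspecified.\<close>
  then have "finite ?L"
    by (meson finite_nat_set_iff_bounded_le)
  moreover have "pair_length (replicate_mset (k - 1) k) (replicate_mset k (k - 1)) = 2 * k - 1"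
    using k by (simp add: pair_length_def)
  then have "2 * k - 1 \<in> ?L"
    using k_irreducible_pair_replicate[OF k] by (metis (mono_tags, lifting) mem_Collect_eq)
  ultimately show "max_length k = 2 * k - 1"
    unfolding max_length_def using le by (intro Max_eqI)
qed

end
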